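(* Let $\{i\}$ be a minimal driver set for the path graph $P_n$ with $3\leq i\leq n-2$. Then $(P_n,\{i\})$ is not strongly $\mathrm{Sym}_0(P_n)$-controllable.
   Context: $P_n$ is the simple undirected path graph with vertex set $V=\{1,\ldots,n\}$ and edge set $\{\{1,2\},\{2,3\},\ldots,\{n-1,n\}\}$. For a simple undirected graph $G=(V,E)$ on $V=\{1,\ldots,n\}$ with (0-1) adjacency matrix $A$ and a non-empty subset $S=\{i_1,\ldots,i_k\}\subseteq V$, $B_S$ denotes the $(n\times k)$-matrix with columns the standard basis vectors $\mathbf{e}_{i_1},\ldots,\mathbf{e}_{i_k}$. A pair $(X,B)$ is controllable if the linear system $\dot{\mathbf{x}}=X\mathbf{x}+B\mathbf{u}$ is controllable. $S$ is a driver set for $G$ if $(A,B_S)$ is controllable; a minimal driver set is a driver set of minimum cardinality. $\mathrm{Sym}_0(G)$ is the set of all real symmetric $(n\times n)$-matrices $X=[x_{ij}]$ with all diagonal entries equal to zero and such that for all $i\neq j$: $x_{ij}\neq 0$ if and only if $\{i,j\}\in E$. $(G,S)$ is strongly $\mathrm{Sym}_0(G)$-controllable if $(X,B_S)$ is controllable for all $X\in \mathrm{Sym}_0(G)$. *)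

theory Defs
  imports "HOL-Analysis.Analysis" "Jordan_Normal_Form.Matrix"
begin

unbundle no vec_syntax
hide_const (open) Finite_Cartesian_Product.vec Finite_Cartesian_Product.row
  Finite_Cartesian_Product.transpose

text \<open>
  A simple graph on the vertex set \<open>{1..n}\<close> is given by \<open>n\<close> and its set of edges, each a
  two-element subset of \<open>{1..n}\<close>. Library vectors and matrices are indexed from 0, so vertex
  \<open>i\<close> corresponds to the index \<open>i - 1\<close>.
\<close>

definition simple_graph :: "nat \<Rightarrow> nat set set \<Rightarrow> bool" where
  "simple_graph n E \<longleftrightarrow> (\<forall>e\<in>E. e \<subseteq> {1..n} \<and> card e = 2)"

definition path_edges :: "nat \<Rightarrow> nat set set" where
  "path_edges n = {{i, i + 1} | i. 1 \<le> i \<and> i < n}"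

lemma simple_graph_path: "simple_graph n (path_edges n)"
  by (auto simp: simple_graph_def path_edges_def)

definition adjacency :: "nat \<Rightarrow> nat set set \<Rightarrow> real mat" where
  "adjacency n E = mat n n (\<lambda>(i, j). if {i + 1, j + 1} \<in> E then 1 else 0)"

definition input_matrix :: "nat \<Rightarrow> nat set \<Rightarrow> real mat" where
  "input_matrix n S = mat_of_cols n (map (\<lambda>i. unit_vec n (i - 1)) (sorted_list_of_set S))"

text \<open>
  State \<open>x\<close> is steered on \<open>[0, T]\<close> by an integrable control \<open>u\<close>, and the equation
  \<open>x' = X x + B u\<close> is understood in integrated form:
  \<open>x t - x 0\<close> is the integral of \<open>X x + B u\<close> over \<open>[0, t]\<close>, component by component.
  For continuous \<open>u\<close> these are exactly the classical solutions.
\<close>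

definition trajectory ::
  "real mat \<Rightarrow> real mat \<Rightarrow> real \<Rightarrow> (real \<Rightarrow> real vec) \<Rightarrow> (real \<Rightarrow> real vec) \<Rightarrow> bool" where
  "trajectory X B T u x \<longleftrightarrow>
     (\<forall>t\<in>{0..T}. u t \<in> carrier_vec (dim_col B)) \<and>
     (\<forall>t\<in>{0..T}. x t \<in> carrier_vec (dim_row X)) \<and>
     (\<forall>j<dim_col B. (\<lambda>t. u t $ j) absolutely_integrable_on {0..T}) \<and>
     (\<forall>t\<in>{0..T}. \<forall>j<dim_row X.
        ((\<lambda>s. (X *\<^sub>v x s + B *\<^sub>v u s) $ j) has_integral (x t $ j - x 0 $ j)) {0..t})"

definition controllable :: "real mat \<Rightarrow> real mat \<Rightarrow> bool" where
  "controllable X B \<longleftrightarrow>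
     (\<forall>x0\<in>carrier_vec (dim_row X). \<forall>x1\<in>carrier_vec (dim_row X).
        \<exists>T>0. \<exists>u x. trajectory X B T u x \<and> x 0 = x0 \<and> x T = x1)"

definition driver_set :: "nat \<Rightarrow> nat set set \<Rightarrow> nat set \<Rightarrow> bool" where
  "driver_set n E S \<longleftrightarrow>
     S \<noteq> {} \<and> S \<subseteq> {1..n} \<and> controllable (adjacency n E) (input_matrix n S)"

definition minimal_driver_set :: "nat \<Rightarrow> nat set set \<Rightarrow> nat set \<Rightarrow> bool" where
  "minimal_driver_set n E S \<longleftrightarrow>
     driver_set n E S \<and> (\<forall>S'. driver_set n E S' \<longrightarrow> card S \<le> card S')"

definition Sym0 :: "nat \<Rightarrow> nat set set \<Rightarrow> real mat set" where
  "Sym0 n E = {X \<in> carrier_mat n n. transpose_mat X = X \<and> (\<forall>i<n. X $$ (i, i) = 0) \<and>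
     (\<forall>i<n. \<forall>j<n. i \<noteq> j \<longrightarrow> (X $$ (i, j) \<noteq> 0 \<longleftrightarrow> {i + 1, j + 1} \<in> E))}"

definition strongly_Sym0_controllable :: "nat \<Rightarrow> nat set set \<Rightarrow> nat set \<Rightarrow> bool" where
  "strongly_Sym0_controllable n E S \<longleftrightarrow>
     (\<forall>X\<in>Sym0 n E. controllable X (input_matrix n S))"

end

theory Submission
  imports Defs
begin

text \<open>
  If \<open>v\<close> is a left eigenvector of \<open>X\<close> annihilated by \<open>B\<close>, then \<open>v \<bullet> x\<close> obeys an autonomous linear
  equation along trajectories, so it stays \<open>0\<close> when started at \<open>0\<close> and \<open>(X, B)\<close> is not
  controllable. Removing vertex \<open>i\<close> from the path leaves two paths with at least two vertices each.
  The normalized adjacency matrix (entries \<open>1 / sqrt (deg j * deg k)\<close>) of each of them has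
  eigenvalue 1 with eigenvector \<open>sqrt deg\<close>. Gluing the two eigenvectors with opposite signs and
  the value 0 at \<open>i\<close> gives an eigenvector of a weighted path matrix that vanishes at \<open>i\<close>.
\<close>

text \<open>Only integrability is assumed, so regularity is gained in two steps: as an indefinite
  integral \<open>y\<close> is continuous, hence so is the integrand, and \<open>y\<close> is
  differentiable with \<open>y' = c y\<close> and \<open>y 0 = 0\<close>.\<close>

lemma integral_equation_zero:
  fixes y :: "real \<Rightarrow> real"
  assumes "T > 0"
    and int: "\<And>t. t \<in> {0..T} \<Longrightarrow> ((\<lambda>s. c * y s) has_integral y t) {0..t}"
  shows "y T = 0"
proof -
  have intT: "(\<lambda>s. c * y s) integrable_on {0..T}"
    using int[of T] assms(1) by auto
  have y_eq: "y t = integral {0..t} (\<lambda>s. c * y s)" if "t \<in> {0..T}" for t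
    using integral_unique[OF int[OF that]] by (rule sym)
  have "continuous_on {0..T} y"
    using indefinite_integral_continuous_1[OF intT] y_eq
    by (metis (no_types, lifting) continuous_on_cong)
  then have cont: "continuous_on {0..T} (\<lambda>s. c * y s)"
    by (intro continuous_intros)
  have y_deriv: "(y has_real_derivative c * y t) (at t within {0..T})" if "t \<in> {0..T}" for t
    by (rule has_field_derivative_transform_within
          [OF integral_has_real_derivative[OF cont that] _ that, where d = 1])
      (use y_eq in auto)
  \<comment> \<open>The integrating factor turns the differential equation into constancy.\<close>
  have "((\<lambda>t. exp (- c * t) * y t) has_real_derivative 0) (at t within {0..T})"
    if "t \<in> {0..T}" for t
    by (rule derivative_eq_intros y_deriv[OF that] refl | simp add: algebra_simps)+
  then obtain k where k: "\<And>t. t \<in> {0..T} \<Longrightarrow> exp (- c * t) * y t = k"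
    using has_field_derivative_zero_constant[of "{0..T}" "\<lambda>t. exp (- c * t) * y t"] by auto
  have "y 0 = 0"
    using y_eq[of 0] assms(1) by simp
  then have "exp (- c * T) * y T = 0"
    using k[of 0] k[of T] assms(1) by simp
  then show ?thesis by simp
qed

lemma not_controllable_if_left_eigenvector:
  assumes X: "X \<in> carrier_mat n n" and B: "B \<in> carrier_mat n m"
    and v: "v \<in> carrier_vec n" "v \<noteq> 0\<^sub>v n"
    and eig: "transpose_mat X *\<^sub>v v = c \<cdot>\<^sub>v v"
    and ann: "transpose_mat B *\<^sub>v v = 0\<^sub>v m"
  shows "\<not> controllable X B"
proof
  assume "controllable X B"
  \<comment> \<open>The unreachable target is \<open>v\<close> itself: along the trajectory
    \<open>v \<bullet> x t\<close> stays 0, but at \<open>v\<close> it would be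
    \<open>v \<bullet> v > 0\<close>.\<close>
  then obtain T u x where T: "T > 0" and tr: "trajectory X B T u x"
    and x0: "x 0 = 0\<^sub>v n" and xT: "x T = v"
    unfolding controllable_def using X v by (metis carrier_matD(1) zero_carrier_vec)
  define y where "y t = v \<bullet> x t" for t
  have x_carr: "x t \<in> carrier_vec n" and u_carr: "u t \<in> carrier_vec m" if "t \<in> {0..T}" for t
    using tr that X B by (auto simp: trajectory_def)
  have rhs: "v \<bullet> (X *\<^sub>v x s + B *\<^sub>v u s) = c * y s" if s: "s \<in> {0..T}" for s
  proof -
    have "v \<bullet> (X *\<^sub>v x s) = c * y s"
      using transpose_vec_mult_scalar[OF X x_carr[OF s] v(1)] eig v x_carr[OF s] by (simp add: y_def)
    moreover have "v \<bullet> (B *\<^sub>v u s) = 0"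
      using transpose_vec_mult_scalar[OF B u_carr[OF s] v(1)] ann u_carr[OF s] by simp
    ultimately show ?thesis
      using X B v x_carr[OF s] u_carr[OF s]
      by (subst scalar_prod_add_distrib[of _ n]) auto
  qed
  have "((\<lambda>s. c * y s) has_integral y t) {0..t}" if t: "t \<in> {0..T}" for t
  proof -
    have "((\<lambda>s. \<Sum>j\<in>{0..<n}. v $ j * (X *\<^sub>v x s + B *\<^sub>v u s) $ j)
        has_integral (\<Sum>j\<in>{0..<n}. v $ j * (x t $ j - x 0 $ j))) {0..t}"
      using tr t X by (intro has_integral_sum has_integral_mult_right) (auto simp: trajectory_def)
    moreover have "(\<Sum>j\<in>{0..<n}. v $ j * (x t $ j - x 0 $ j)) = y t"
      using x_carr[OF t] by (simp add: y_def scalar_prod_def x0)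
    ultimately have "((\<lambda>s. v \<bullet> (X *\<^sub>v x s + B *\<^sub>v u s)) has_integral y t) {0..t}"
      using B by (simp add: scalar_prod_def)
    then show ?thesis
      by (rule has_integral_eq[rotated]) (use rhs t in auto)
  qed
  then have "v \<bullet> v = 0"
    using integral_equation_zero[OF T, of c y] by (simp add: y_def xT)
  moreover have "v \<bullet> v > 0"
  proof -
    obtain j where j: "j < n" "v $ j \<noteq> 0"
      using v by (metis carrier_vecD eq_vecI index_zero_vec)
    have "0 < (\<Sum>j\<in>{0..<n}. v $ j * v $ j)"
      using j by (intro sum_pos2[of _ j]) (auto simp: zero_less_mult_iff)
    then show ?thesis using v by (simp add: scalar_prod_def)
  qed
  ultimately show False by simp
qed

text \<open>
  Square root of the degree of \<open>j\<close> in the path with vertex \<open>i\<close> removed; the removed vertex itself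
  gets the value 1.
\<close>

definition split_weight :: "nat \<Rightarrow> nat \<Rightarrow> nat \<Rightarrow> real" where
  "split_weight n i j = (if j \<in> {1, i - 1, i, i + 1, n} then 1 else sqrt 2)"

definition split_sign :: "nat \<Rightarrow> nat \<Rightarrow> real" where
  "split_sign i j = (if j < i then 1 else if j = i then 0 else - 1)"

text \<open>The functions above take vertices from 1 on; row \<open>j\<close> belongs to vertex \<open>Suc j\<close>.\<close>

definition split_matrix :: "nat \<Rightarrow> nat \<Rightarrow> real mat" where
  "split_matrix n i = mat n n (\<lambda>(j, k). if k = Suc j \<or> j = Suc k
     then 1 / (split_weight n i (Suc j) * split_weight n i (Suc k)) else 0)"

definition split_vector :: "nat \<Rightarrow> nat \<Rightarrow> real vec" where
  "split_vector n i = vec n (\<lambda>j. split_sign i (Suc j) * split_weight n i (Suc j))"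

lemma split_weight_pos: "split_weight n i j > 0"
  by (simp add: split_weight_def)

lemma mem_path_edges_iff:
  assumes "j < n" "k < n"
  shows "{j + 1, k + 1} \<in> path_edges n \<longleftrightarrow> k = Suc j \<or> j = Suc k"
  using assms by (auto simp: path_edges_def doubleton_eq_iff)

lemma split_matrix_in_Sym0: "split_matrix n i \<in> Sym0 n (path_edges n)"
proof -
  have "split_weight n i j \<noteq> 0" for j
    using split_weight_pos[of n i j] by simp
  then show ?thesis
    by (auto simp: Sym0_def split_matrix_def mem_path_edges_iff[simplified] mult.commute
        intro!: eq_matI)
qed

lemma sum_path_neighbours:
  fixes f :: "nat \<Rightarrow> 'a::comm_monoid_add"
  assumes "j < n"
  shows "(\<Sum>k\<in>{0..<n}. if k = Suc j \<or> j = Suc k then f k else 0) =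
    (if 0 < j then f (j - 1) else 0) + (if Suc j < n then f (Suc j) else 0)"
proof -
  \<comment> \<open>For \<open>j = 0\<close> truncated subtraction gives \<open>j - 1 = 0\<close>,
    hence the inner test \<open>0 < j\<close>.\<close>
  have "(\<Sum>k\<in>{0..<n}. if k = Suc j \<or> j = Suc k then f k else 0) =
    (\<Sum>k\<in>{0..<n}. (if k = j - 1 then if 0 < j then f k else 0 else 0) +
      (if k = Suc j then f k else 0))"
    by (intro sum.cong) auto
  moreover have "j - 1 < n"
    using assms by simp
  ultimately show ?thesis
    by (simp add: sum.distrib)
qed

text \<open>This is the eigenvalue equation with the weights cancelled. Away from \<open>i\<close>,
  neighbours other than \<open>i\<close> share the sign of the vertex and \<open>i\<close>
  contributes 0, so the sum is sign times degree. At \<open>i\<close> the neighbours cancel. The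
  bounds on \<open>i\<close> give each of 1, \<open>i - 1\<close>, \<open>i + 1\<close> and
  \<open>n\<close> exactly one neighbour other than \<open>i\<close>, matching weight 1.\<close>

lemma split_sign_neighbours:
  assumes "3 \<le> i" "i + 2 \<le> n" "j < n"
  shows "(if 0 < j then split_sign i j else 0) +
      (if Suc j < n then split_sign i (Suc (Suc j)) else 0) =
    split_sign i (Suc j) * (split_weight n i (Suc j))\<^sup>2"
  using assms by (auto simp: split_sign_def split_weight_def)

lemma split_matrix_eigenvector:
  assumes "3 \<le> i" "i + 2 \<le> n"
  shows "split_matrix n i *\<^sub>v split_vector n i = split_vector n i"
proof (rule eq_vecI)
  fix j assume "j < dim_vec (split_vector n i)"
  then have j: "j < n" by (simp add: split_vector_def)
  define w where "w = split_weight n i"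
  have w: "w k \<noteq> 0" for k
    using split_weight_pos[of n i k] by (simp add: w_def)
  \<comment> \<open>The weight of the neighbour \<open>Suc k\<close> in the vector cancels against
    the one in the matrix entry.\<close>
  have "(split_matrix n i *\<^sub>v split_vector n i) $ j =
    (\<Sum>k\<in>{0..<n}. if k = Suc j \<or> j = Suc k then split_sign i (Suc k) / w (Suc j) else 0)"
    using j w by (auto simp: split_matrix_def split_vector_def scalar_prod_def w_def
        intro!: sum.cong)
  also have "\<dots> = ((if 0 < j then split_sign i j else 0) +
      (if Suc j < n then split_sign i (Suc (Suc j)) else 0)) / w (Suc j)"
    using j by (subst sum_path_neighbours) (auto simp: add_divide_distrib)
  also have "\<dots> = split_vector n i $ j"
    using j w[of "Suc j"]
    by (subst split_sign_neighbours[OF assms j])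
      (simp add: split_vector_def w_def power2_eq_square)
  finally show "(split_matrix n i *\<^sub>v split_vector n i) $ j = split_vector n i $ j" .
qed (simp add: split_matrix_def split_vector_def)

theorem theorem19:
  fixes n i :: nat
  assumes "3 \<le> i" and "i \<le> n - 2"
    and "minimal_driver_set n (path_edges n) {i}"
  shows "\<not> strongly_Sym0_controllable n (path_edges n) {i}"
proof -
  have i: "3 \<le> i" "i + 2 \<le> n" using assms by auto
  let ?X = "split_matrix n i" and ?v = "split_vector n i" and ?B = "input_matrix n {i}"
  have X: "?X \<in> carrier_mat n n" by (simp add: split_matrix_def)
  have B: "?B \<in> carrier_mat n 1" by (simp add: input_matrix_def mat_of_cols_def)
  have v: "?v \<in> carrier_vec n" by (simp add: split_vector_def)
  have "?v $ 0 \<noteq> 0"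
    using i by (simp add: split_vector_def split_sign_def split_weight_def)
  then have v0: "?v \<noteq> 0\<^sub>v n" using i by auto
  \<comment> \<open>Symmetry of the matrix makes the right eigenvector a left one.\<close>
  have eig: "transpose_mat ?X *\<^sub>v ?v = 1 \<cdot>\<^sub>v ?v"
    using split_matrix_in_Sym0[of n i] split_matrix_eigenvector[OF i] by (simp add: Sym0_def)
  have "col ?B 0 = unit_vec n (i - 1)"
    by (simp add: input_matrix_def)
  moreover have "?v $ (i - 1) = 0"
    using i by (simp add: split_vector_def split_sign_def)
  ultimately have ann: "transpose_mat ?B *\<^sub>v ?v = 0\<^sub>v 1"
    using B v i by (intro eq_vecI) auto
  have "\<not> controllable ?X ?B"
    by (rule not_controllable_if_left_eigenvector[OF X B v v0 eig ann])
  then show ?thesis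
    using split_matrix_in_Sym0[of n i] by (auto simp: strongly_Sym0_controllable_def)
qed

end
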